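(* Let $\mathcal{T}=(V,E,T)$ be an arborescence with thresholds. Then the monoid $M(\mathcal{T})=\langle \sigma_v,\tau_v : v\in V\rangle$ of self-maps of $\Omega(\mathcal{T})$ is $\mathscr{R}$-trivial, i.e. for all $a,b\in M(\mathcal{T})$, $aM(\mathcal{T})=bM(\mathcal{T})$ implies $a=b$.
   Context: An arborescence is a finite directed tree with vertex set $V$, edge set $E$ and a special vertex $r\in V$ (the root) such that there is exactly one directed path from any vertex to $r$. For $v\in V$, $v^\downarrow=(v=v_0\to v_1\to\cdots\to v_a=r)$ denotes this path. Each vertex $v$ has a threshold $T_v$, a positive integer. Put $\Omega(\mathcal{T})=\{(t_v)_{v\in V} : t_v\in\mathbb{Z},\ 0\le t_v\le T_v\}$. For every $v\in V$ (not only leaves) the operator $\sigma_v:\Omega(\mathcal{T})\to\Omega(\mathcal{T})$ is: with $v^\downarrow=(v_0\to\cdots\to v_a)$, let $k\ge0$ be smallest with $t_{v_k}<T_{v_k}$; then $\sigma_v(t)$ is $t$ with $t_{v_k}$ increased by $1$; if no such $k$ exists, $\sigma_v(t)=t$. The operator $\theta_v$: if $t_v=0$, $\theta_v(t)=t$. If $t_v>0$, let $k\ge1$ be smallest with $t_{v_k}<T_{v_k}$; then $\theta_v(t)$ is $t$ with $t_v$ decreased by $1$ and $t_{v_k}$ increased by $1$; if no such $k$ exists, $\theta_v(t)$ is $t$ with $t_v$ decreased by $1$. Put $\tau_v=\theta_v^{T_v}$. $M(\mathcal{T})$ is the monoid, under composition of maps ($(fg)(t)=f(g(t))$), generated by these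 operators (it contains the identity map). *)

theory Defs
  imports "Graph_Theory.Graph_Theory" "HOL-Algebra.Coset"
begin

section \<open>Arborescences with thresholds\<close>

text \<open>
  A directed tree is an orientation of an undirected tree. The predicate \<open>tree\<close> of the graph
  library is not used: it only forbids directed cycles. In the symmetric digraph
  \<^term>\<open>mk_symmetric G\<close> every edge \<open>uv\<close> gives rise to the arc cycle \<open>u, v, u\<close>, so cycles of the
  underlying undirected graph are the arc cycles of length at least 3; the remaining possible
  undirected cycle, a pair of opposite arcs of \<open>G\<close>, is excluded separately. (Loops and
  parallel arcs are excluded by \<^const>\<open>digraph\<close>.)
\<close>

definition directed_tree :: "('v, 'e) pre_digraph \<Rightarrow> bool" where
  "directed_tree G \<longleftrightarrow>
     digraph G \<and> Digraph_Component.connected G \<and>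
     (\<forall>u v. u \<rightarrow>\<^bsub>G\<^esub> v \<longrightarrow> \<not> v \<rightarrow>\<^bsub>G\<^esub> u) \<and>
     \<not> (\<exists>p. pre_digraph.cycle (with_proj (mk_symmetric G)) p \<and> 3 \<le> length p)"

definition arborescence :: "('v, 'e) pre_digraph \<Rightarrow> 'v \<Rightarrow> bool" where
  "arborescence G r \<longleftrightarrow>
     directed_tree G \<and> r \<in> verts G \<and> (\<forall>v\<in>verts G. \<exists>!p. pre_digraph.apath G v p r)"

locale arborescence_with_thresholds =
  fixes G :: "('v, 'e) pre_digraph" and r :: 'v and T :: "'v \<Rightarrow> nat"
  assumes arborescence: "arborescence G r"
    and threshold_pos: "v \<in> verts G \<Longrightarrow> 0 < T v"

text \<open>The vertex sequence \<open>[v\<^sub>0, \<dots>, v\<^sub>a]\<close> of the path from \<open>v = v\<^sub>0\<close> to the root \<open>v\<^sub>a = r\<close>.\<close>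

definition root_path :: "('v, 'e) pre_digraph \<Rightarrow> 'v \<Rightarrow> 'v \<Rightarrow> 'v list" where
  "root_path G r v = pre_digraph.awalk_verts G v (THE p. pre_digraph.apath G v p r)"

text \<open>States are functions on \<^term>\<open>verts G\<close>, made total by the value \<^term>\<open>undefined\<close> elsewhere.\<close>

definition states :: "('v, 'e) pre_digraph \<Rightarrow> ('v \<Rightarrow> nat) \<Rightarrow> ('v \<Rightarrow> nat) set" where
  "states G T = (\<Pi>\<^sub>E v\<in>verts G. {0..T v})"


section \<open>The operators\<close>

text \<open>
  \<open>below_threshold G r T t v k\<close>: the \<open>k\<close>-th vertex of the path from \<open>v\<close> to the root exists
  and its value in \<open>t\<close> is below its threshold.
\<close>

definition below_threshold ::
  "('v, 'e) pre_digraph \<Rightarrow> 'v \<Rightarrow> ('v \<Rightarrow> nat) \<Rightarrow> ('v \<Rightarrow> nat) \<Rightarrow> 'v \<Rightarrow> nat \<Rightarrow> bool" where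
  "below_threshold G r T t v k \<longleftrightarrow>
     k < length (root_path G r v) \<and> t (root_path G r v ! k) < T (root_path G r v ! k)"

definition sigma ::
  "('v, 'e) pre_digraph \<Rightarrow> 'v \<Rightarrow> ('v \<Rightarrow> nat) \<Rightarrow> 'v \<Rightarrow> ('v \<Rightarrow> nat) \<Rightarrow> ('v \<Rightarrow> nat)" where
  "sigma G r T v = (\<lambda>t\<in>states G T.
     if \<exists>k. below_threshold G r T t v k then
       let w = root_path G r v ! (LEAST k. below_threshold G r T t v k)
       in t(w := t w + 1)
     else t)"

definition theta ::
  "('v, 'e) pre_digraph \<Rightarrow> 'v \<Rightarrow> ('v \<Rightarrow> nat) \<Rightarrow> 'v \<Rightarrow> ('v \<Rightarrow> nat) \<Rightarrow> ('v \<Rightarrow> nat)" where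
  "theta G r T v = (\<lambda>t\<in>states G T.
     if t v = 0 then t
     else if \<exists>k\<ge>1. below_threshold G r T t v k then
       let w = root_path G r v ! (LEAST k. 1 \<le> k \<and> below_threshold G r T t v k)
       in t(v := t v - 1, w := t w + 1)
     else t(v := t v - 1))"


section \<open>The monoid generated by the operators\<close>

definition self_maps :: "'a set \<Rightarrow> ('a \<Rightarrow> 'a) monoid" where
  "self_maps S = \<lparr>carrier = S \<rightarrow>\<^sub>E S, monoid.mult = (\<lambda>f g. compose S f g), one = (\<lambda>x\<in>S. x)\<rparr>"

definition tau ::
  "('v, 'e) pre_digraph \<Rightarrow> 'v \<Rightarrow> ('v \<Rightarrow> nat) \<Rightarrow> 'v \<Rightarrow> ('v \<Rightarrow> nat) \<Rightarrow> ('v \<Rightarrow> nat)" where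
  "tau G r T v = theta G r T v [^]\<^bsub>self_maps (states G T)\<^esub> T v"

inductive_set generated_submonoid :: "('a, 'b) monoid_scheme \<Rightarrow> 'a set \<Rightarrow> 'a set"
  for M and A where
  one: "\<one>\<^bsub>M\<^esub> \<in> generated_submonoid M A"
| incl: "a \<in> A \<Longrightarrow> a \<in> generated_submonoid M A"
| mult: "a \<in> generated_submonoid M A \<Longrightarrow> b \<in> generated_submonoid M A \<Longrightarrow>
    a \<otimes>\<^bsub>M\<^esub> b \<in> generated_submonoid M A"

definition threshold_monoid ::
  "('v, 'e) pre_digraph \<Rightarrow> 'v \<Rightarrow> ('v \<Rightarrow> nat) \<Rightarrow> (('v \<Rightarrow> nat) \<Rightarrow> ('v \<Rightarrow> nat)) monoid" where
  "threshold_monoid G r T =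
     (self_maps (states G T))
       \<lparr>carrier := generated_submonoid (self_maps (states G T))
          (sigma G r T ` verts G \<union> tau G r T ` verts G)\<rparr>"

text \<open>\<^term>\<open>a <#\<^bsub>M\<^esub> carrier M\<close> is the principal right ideal \<open>a M\<close>.\<close>

definition R_trivial :: "('a, 'b) monoid_scheme \<Rightarrow> bool" where
  "R_trivial M \<longleftrightarrow>
     (\<forall>a\<in>carrier M. \<forall>b\<in>carrier M. a <#\<^bsub>M\<^esub> carrier M = b <#\<^bsub>M\<^esub> carrier M \<longrightarrow> a = b)"


section \<open>Well-definedness\<close>

lemma monoid_self_maps: "monoid (self_maps S)"
proof (rule monoidI)
  fix f g h
  assume "f \<in> carrier (self_maps S)" "g \<in> carrier (self_maps S)" "h \<in> carrier (self_maps S)"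
  then show "f \<otimes>\<^bsub>self_maps S\<^esub> g \<otimes>\<^bsub>self_maps S\<^esub> h = f \<otimes>\<^bsub>self_maps S\<^esub> (g \<otimes>\<^bsub>self_maps S\<^esub> h)"
    by (auto simp: self_maps_def compose_def fun_eq_iff)
qed (auto simp: self_maps_def compose_def fun_eq_iff PiE_iff extensional_def)

context arborescence_with_thresholds
begin

lemma apath_root_path:
  assumes "v \<in> verts G"
  shows "pre_digraph.apath G v (THE p. pre_digraph.apath G v p r) r"
proof -
  have "\<exists>!p. pre_digraph.apath G v p r"
    using assms arborescence by (simp add: arborescence_def)
  then show ?thesis by (rule theI')
qed

lemma root_path_facts:
  assumes "v \<in> verts G"
  shows "set (root_path G r v) \<subseteq> verts G" "distinct (root_path G r v)"
    "root_path G r v \<noteq> []" "root_path G r v ! 0 = v" "last (root_path G r v) = r"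
proof -
  have dg: "digraph G"
    using arborescence by (simp add: arborescence_def directed_tree_def)
  interpret digraph G by (rule dg)
  let ?p = "THE p. pre_digraph.apath G v p r"
  have p: "awalk v ?p r" "distinct (awalk_verts v ?p)"
    using apath_root_path[OF assms] by (auto simp: apath_def)
  then show "set (root_path G r v) \<subseteq> verts G" "distinct (root_path G r v)"
    "root_path G r v \<noteq> []" "last (root_path G r v) = r"
    by (auto simp: root_path_def)
  then show "root_path G r v ! 0 = v"
    using p(1) hd_conv_nth[of "root_path G r v"] by (auto simp: root_path_def)
qed

lemma below_threshold_vertex:
  assumes "v \<in> verts G" "below_threshold G r T t v k"
  shows "root_path G r v ! k \<in> verts G" "t (root_path G r v ! k) < T (root_path G r v ! k)"
proof -
  have k: "k < length (root_path G r v)"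
    using assms(2) by (simp add: below_threshold_def)
  show "root_path G r v ! k \<in> verts G"
    using root_path_facts(1)[OF assms(1)] nth_mem[OF k] by (rule subsetD)
  show "t (root_path G r v ! k) < T (root_path G r v ! k)"
    using assms(2) by (simp add: below_threshold_def)
qed

lemma sigma_closed:
  assumes v: "v \<in> verts G"
  shows "sigma G r T v \<in> states G T \<rightarrow>\<^sub>E states G T"
proof (unfold sigma_def, rule restrict_PiE_iff[THEN iffD2], rule ballI)
  fix t assume t: "t \<in> states G T"
  define w where "w = root_path G r v ! (LEAST k. below_threshold G r T t v k)"
  have "t(w := t w + 1) \<in> states G T" if "\<exists>k. below_threshold G r T t v k"
    using below_threshold_vertex[OF v LeastI_ex[OF that], folded w_def] t
    by (auto simp: states_def PiE_iff extensional_def)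
  then show "(if \<exists>k. below_threshold G r T t v k then
      let w = root_path G r v ! (LEAST k. below_threshold G r T t v k) in t(w := t w + 1)
      else t) \<in> states G T"
    using t unfolding Let_def w_def by (cases "\<exists>k. below_threshold G r T t v k") simp_all
qed

lemma theta_closed:
  assumes v: "v \<in> verts G"
  shows "theta G r T v \<in> states G T \<rightarrow>\<^sub>E states G T"
proof (unfold theta_def, rule restrict_PiE_iff[THEN iffD2], rule ballI)
  fix t assume t: "t \<in> states G T"
  define w where "w = root_path G r v ! (LEAST k. 1 \<le> k \<and> below_threshold G r T t v k)"
  have dec: "t(v := t v - 1) \<in> states G T"
    using v t by (auto simp: states_def PiE_iff extensional_def)
  have "t(v := t v - 1, w := t w + 1) \<in> states G T"
    if "\<exists>k\<ge>1. below_threshold G r T t v k"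
    using below_threshold_vertex[OF v LeastI_ex[OF that, THEN conjunct2], folded w_def] v t
    by (auto simp: states_def PiE_iff extensional_def)
  then show "(if t v = 0 then t
      else if \<exists>k\<ge>1. below_threshold G r T t v k then
        let w = root_path G r v ! (LEAST k. 1 \<le> k \<and> below_threshold G r T t v k)
        in t(v := t v - 1, w := t w + 1)
      else t(v := t v - 1)) \<in> states G T"
    using t dec unfolding Let_def w_def
    by (cases "t v = 0"; cases "\<exists>k\<ge>1. below_threshold G r T t v k") simp_all
qed

lemma generators_closed:
  "sigma G r T ` verts G \<union> tau G r T ` verts G \<subseteq> carrier (self_maps (states G T))"
proof -
  interpret S: monoid "self_maps (states G T)" by (rule monoid_self_maps)
  have "theta G r T v \<in> carrier (self_maps (states G T))" if "v \<in> verts G" for v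
    using theta_closed[OF that] by (simp add: self_maps_def)
  then show ?thesis
    using sigma_closed by (auto simp: tau_def) (simp add: self_maps_def)
qed

lemma monoid_threshold_monoid: "monoid (threshold_monoid G r T)"
proof -
  interpret S: monoid "self_maps (states G T)" by (rule monoid_self_maps)
  let ?H = "generated_submonoid (self_maps (states G T))
    (sigma G r T ` verts G \<union> tau G r T ` verts G)"
  have "x \<in> carrier (self_maps (states G T))" if "x \<in> ?H" for x
    using that by induction (use generators_closed in auto)
  then have "submonoid ?H (self_maps (states G T))"
    by (auto simp: submonoid_def intro: generated_submonoid.intros)
  then show ?thesis
    unfolding threshold_monoid_def by (rule submonoid.submonoid_is_monoid) (rule monoid_self_maps)
qed

end

end

(*
  If a = b c and b = a d, then a = a w^N for w = d c and every N, so a = b follows once w^N x = w^N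
  for every generator x occurring in w and all large N. This is shown one vertex v at a time, from
  the leaves to the root; the value of sigma_u(t) or tau_u(t) at v depends only on the values of t
  in the subtree of v. If tau_v occurs in w, it resets v to 0, and agreement of w^N t and w^N x t
  strictly below v extends to v after one more application of w. Otherwise no generator in w lowers
  the value at v, and as long as v stays below its threshold no grain leaves the subtree of v. So the
  number of grains in the subtree grows by a constant n for each application of w. If n > 0, then v
  is full for large N. If n = 0, then x adds no grain below v either, and comparing the numbers of
  grains for w^N t and w^N x t gives agreement at v.
*)

theory Submission
  imports Defs
begin

context arborescence_with_thresholds
begin

section \<open>Paths to the root and subtrees\<close>

abbreviation \<Omega> where "\<Omega> \<equiv> states G T"
abbreviation path where "path \<equiv> root_path G r"
abbreviation S where "S \<equiv> self_maps \<Omega>"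

text \<open>Cutting the path of \<open>v\<close> at its \<open>k\<close>-th vertex leaves a path
  without repeated vertices from that vertex to the root, and such a path is unique.\<close>

lemma root_path_nth:
  assumes v: "v \<in> verts G" and k: "k < length (path v)"
  shows "path (path v ! k) = drop k (path v)"
proof -
  have dg: "digraph G"
    using arborescence by (simp add: arborescence_def directed_tree_def)
  interpret digraph G by (rule dg)
  define p where "p = (THE p. apath v p r)"
  have p: "apath v p r" using apath_root_path[OF v] by (simp add: p_def)
  have path_v: "path v = awalk_verts v p" by (simp add: root_path_def p_def)
  define q where "q = drop k p"
  define u where "u = awlast v (take k p)"
  have kl: "k \<le> length p"
    using k by (simp add: path_v length_awalk_verts)
  have "awalk v (take k p @ q) r" using p by (simp add: q_def apath_def)
  then have aw: "awalk v (take k p) u" "awalk u q r" by (simp_all add: u_def)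
  have split: "awalk_verts v p = awalk_verts v (take k p) @ tl (awalk_verts u q)"
    using awalk_verts_append[of v "take k p" q r] \<open>awalk v (take k p @ q) r\<close>
    by (simp add: q_def u_def)
  \<comment> \<open>A walk with \<open>k\<close> arcs visits \<open>k + 1\<close> vertices, so index
    \<open>k\<close> is its last vertex \<open>u\<close>, where the two pieces are glued.\<close>
  have len: "length (awalk_verts v (take k p)) = Suc k"
    using kl by (simp add: length_awalk_verts)
  have last: "last (awalk_verts v (take k p)) = u" by (simp add: u_def)
  have nth: "path v ! k = u"
    unfolding path_v split using len last
    by (metis diff_Suc_1 last_conv_nth length_0_conv lessI nat.simps(3) nth_append)
  have "drop k (awalk_verts v (take k p)) = [u]"
    using len last
    by (metis append_butlast_last_id append_eq_conv_conj diff_Suc_1 length_butlast list.size(3) nat.distinct(1))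
  moreover have "awalk_verts u q = u # tl (awalk_verts u q)"
    using awhd_of_awalk[OF aw(2)] awalk_verts_non_Nil[of u q] by (cases "awalk_verts u q") auto
  ultimately have drop: "drop k (path v) = awalk_verts u q"
    unfolding path_v split using len by simp
  have "distinct (awalk_verts u q)"
    using root_path_facts(2)[OF v] drop by (metis distinct_drop)
  then have uq: "apath u q r" using aw(2) by (simp add: apath_def)
  have uv: "u \<in> verts G" using aw(2) by auto
  have "\<exists>!p. apath u p r"
    using uv arborescence by (simp add: arborescence_def)
  then have "(THE p. apath u p r) = q" using uq by (rule the1_equality)
  then have "path u = awalk_verts u q" by (simp add: root_path_def)
  then show ?thesis by (simp add: nth drop)
qed

lemma root_path_nth_neq:
  assumes "u \<in> verts G" "1 \<le> k" "k < length (path u)"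
  shows "path u ! k \<noteq> u"
  using root_path_facts(2,4)[OF assms(1)] assms(2,3)
  by (metis not_one_le_zero nth_eq_iff_index_eq order_le_less_trans zero_le)

definition subtree :: "'v \<Rightarrow> 'v set" where
  "subtree v = {u \<in> verts G. v \<in> set (path u)}"

lemma finite_verts: "finite (verts G)"
proof -
  interpret digraph G
    using arborescence by (simp add: arborescence_def directed_tree_def)
  show ?thesis by simp
qed

lemma finite_subtree: "finite (subtree v)"
  using finite_verts by (simp add: subtree_def)

lemma subtree_subset: "subtree v \<subseteq> verts G"
  by (auto simp: subtree_def)

lemma root_path_subset: "v \<in> verts G \<Longrightarrow> u \<in> set (path v) \<Longrightarrow> u \<in> verts G"
  using root_path_facts(1) by blast

lemma self_mem_subtree: "v \<in> verts G \<Longrightarrow> v \<in> subtree v"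
  using root_path_facts(3,4)[of v] by (metis (mono_tags, lifting) length_greater_0_conv mem_Collect_eq nth_mem subtree_def)

lemma nth_mem_subtree_nth:
  assumes "u \<in> verts G" "j \<le> k" "k < length (path u)"
  shows "path u ! j \<in> subtree (path u ! k)"
proof -
  have "path u ! k = drop j (path u) ! (k - j)" using assms by simp
  also have "\<dots> \<in> set (drop j (path u))" using assms by (intro nth_mem) simp
  finally show ?thesis
    using assms root_path_nth[of u j] root_path_subset[of u "path u ! j"] by (simp add: subtree_def)
qed

lemma subtree_trans:
  assumes "u \<in> subtree d" "d \<in> subtree v"
  shows "u \<in> subtree v"
proof -
  obtain k where k: "k < length (path u)" "path u ! k = d" and u: "u \<in> verts G"
    using assms(1) by (auto simp: subtree_def in_set_conv_nth)
  have "v \<in> set (drop k (path u))"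
    using assms(2) root_path_nth[OF u k(1)] k(2) by (simp add: subtree_def)
  then show ?thesis using u by (auto simp: subtree_def dest: in_set_dropD)
qed

text \<open>Makes path length a measure for the induction from the leaves to the root, and shows
  that two distinct vertices cannot lie in each other's subtrees.\<close>

lemma length_root_path_less:
  assumes "u \<in> subtree v" "u \<noteq> v"
  shows "length (path v) < length (path u)"
proof -
  obtain k where k: "k < length (path u)" "path u ! k = v" and u: "u \<in> verts G"
    using assms(1) by (auto simp: subtree_def in_set_conv_nth)
  have "k \<noteq> 0" using assms(2) k(2) root_path_facts(4)[OF u] by metis
  then show ?thesis using root_path_nth[OF u k(1)] k by simp
qed

section \<open>Moving a single grain towards the root\<close>

text \<open>The start index \<open>i\<close> is 0 for \<open>\<sigma>\<close> and 1 for \<open>\<theta>\<close>.\<close>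

definition deposit :: "nat \<Rightarrow> 'v \<Rightarrow> ('v \<Rightarrow> nat) \<Rightarrow> 'v \<Rightarrow> nat" where
  "deposit i u t = (if \<exists>k\<ge>i. below_threshold G r T t u k
     then let w = path u ! (LEAST k. i \<le> k \<and> below_threshold G r T t u k) in t(w := t w + 1)
     else t)"

lemma sigma_eq_deposit: "t \<in> \<Omega> \<Longrightarrow> sigma G r T u t = deposit 0 u t"
  by (auto simp: sigma_def deposit_def)

text \<open>The search from index 1 never meets \<open>u\<close> again, since the path has no
  repetitions. Hence lowering \<open>t u\<close> before the search does not change its
  result.\<close>

lemma theta_eq_deposit:
  assumes "u \<in> verts G" "t \<in> \<Omega>"
  shows "theta G r T u t = (if t u = 0 then t else deposit 1 u (t(u := t u - 1)))"
proof -
  note ne = root_path_nth_neq[OF assms(1)]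
  have eq: "(1 \<le> k \<and> below_threshold G r T (t(u := t u - 1)) u k) \<longleftrightarrow>
      (1 \<le> k \<and> below_threshold G r T t u k)" for k
    using ne by (auto simp: below_threshold_def)
  have "path u ! (LEAST k. 1 \<le> k \<and> below_threshold G r T t u k) \<noteq> u"
    if "\<exists>k\<ge>1. below_threshold G r T t u k"
    using LeastI_ex[OF that] ne by (auto simp: below_threshold_def)
  then show ?thesis
    using assms(2) unfolding theta_def deposit_def eq by (auto simp: Let_def)
qed

lemma deposit_cases:
  obtains (none) "deposit i u t = t" "\<And>k. i \<le> k \<Longrightarrow> \<not> below_threshold G r T t u k"
  | (target) k where "deposit i u t = t(path u ! k := t (path u ! k) + 1)" "i \<le> k"
    "below_threshold G r T t u k" "\<And>j. i \<le> j \<Longrightarrow> j < k \<Longrightarrow> \<not> below_threshold G r T t u j"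
proof (cases "\<exists>k\<ge>i. below_threshold G r T t u k")
  case True
  define k where "k = (LEAST k. i \<le> k \<and> below_threshold G r T t u k)"
  have "i \<le> k \<and> below_threshold G r T t u k"
    unfolding k_def using True by (rule LeastI_ex)
  moreover have "\<not> below_threshold G r T t u j" if "i \<le> j" "j < k" for j
    using not_less_Least that unfolding k_def by blast
  ultimately show thesis
    using True target[of k] by (simp add: deposit_def Let_def k_def)
next
  case False
  then show thesis by (intro none) (auto simp: deposit_def)
qed

text \<open>A pointwise form without \<open>LEAST\<close>, so that two states can be compared one
  index at a time.\<close>

lemma deposit_apply:
  "deposit i u t d = (if \<exists>k\<ge>i. path u ! k = d \<and> below_threshold G r T t u k \<and>
     (\<forall>j. i \<le> j \<longrightarrow> j < k \<longrightarrow> \<not> below_threshold G r T t u j) then t d + 1 else t d)"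
  (is "_ = (if ?P then _ else _)")
proof (cases rule: deposit_cases[of i u t])
  case none
  then have "\<not> ?P" by blast
  then show ?thesis using none(1) by simp
next
  case (target k)
  show ?thesis
  proof (cases "path u ! k = d")
    case True
    then have ?P using target(2-4) by blast
    then show ?thesis using target(1) True by simp
  next
    case False
    have "\<not> ?P" using target(2-4) False by (metis linorder_neqE_nat)
    then show ?thesis using target(1) False by simp
  qed
qed

text \<open>Whether the grain stops at \<open>d\<close> is decided by the vertices of the path from
  \<open>u\<close> up to \<open>d\<close>, and all of these lie in the subtree of
  \<open>d\<close>.\<close>

lemma deposit_local:
  assumes u: "u \<in> verts G" and d: "d \<in> verts G"
    and agree: "\<And>e. e \<in> subtree d \<Longrightarrow> s e = t e"
  shows "deposit i u s d = deposit i u t d"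
proof -
  have eq: "below_threshold G r T s u j \<longleftrightarrow> below_threshold G r T t u j"
    if "j \<le> k" "k < length (path u)" "path u ! k = d" for j k
    using agree nth_mem_subtree_nth[OF u that(1,2)] that(3) by (simp add: below_threshold_def)
  have "(path u ! k = d \<and> below_threshold G r T s u k \<and>
     (\<forall>j. i \<le> j \<longrightarrow> j < k \<longrightarrow> \<not> below_threshold G r T s u j)) \<longleftrightarrow>
     (path u ! k = d \<and> below_threshold G r T t u k \<and>
     (\<forall>j. i \<le> j \<longrightarrow> j < k \<longrightarrow> \<not> below_threshold G r T t u j))" for k
  proof (cases "k < length (path u) \<and> path u ! k = d")
    case True
    then show ?thesis using eq[of _ k] by (metis order.order_iff_strict)
  qed (auto simp: below_threshold_def)
  then show ?thesis
    unfolding deposit_apply using agree[OF self_mem_subtree[OF d]] by presburger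
qed

section \<open>Grain counts in subtrees\<close>

definition grains :: "'v \<Rightarrow> ('v \<Rightarrow> nat) \<Rightarrow> nat" where
  "grains v t = sum t (subtree v)"

text \<open>The old value is added on the left instead of being subtracted on the right, which
  avoids truncated subtraction.\<close>

lemma grains_fun_upd:
  "grains v (t(w := x)) + (if w \<in> subtree v then t w else 0) =
   grains v t + (if w \<in> subtree v then x else 0)"
proof (cases "w \<in> subtree v")
  case True
  have "sum (t(w := x)) (subtree v - {w}) = sum t (subtree v - {w})"
    by (intro sum.cong) auto
  then show ?thesis
    using True finite_subtree[of v] by (simp add: grains_def sum.remove[of _ w])
next
  case False
  then have "sum (t(w := x)) (subtree v) = sum t (subtree v)"
    by (intro sum.cong) auto
  then show ?thesis using False by (simp add: grains_def)
qed

lemma deposit_increasing: "t v \<le> deposit i u t v"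
  by (simp add: deposit_apply)

lemma grains_deposit_le: "grains v (deposit i u t) \<le> grains v t + 1"
proof (cases rule: deposit_cases[of i u t])
  case (target k)
  then show ?thesis
    using grains_fun_upd[of v t "path u ! k" "t (path u ! k) + 1"] by (simp split: if_splits)
qed simp

text \<open>A grain from \<open>u\<close> lands only at a vertex whose subtree contains
  \<open>u\<close>; if that vertex were below \<open>v\<close>, then \<open>u\<close> would be
  too.\<close>

lemma grains_deposit_outside:
  assumes "u \<in> verts G" "u \<notin> subtree v"
  shows "grains v (deposit i u t) = grains v t"
proof (cases rule: deposit_cases[of i u t])
  case (target k)
  have "k < length (path u)" using target(3) by (simp add: below_threshold_def)
  then have "u \<in> subtree (path u ! k)"
    using assms(1) by (simp add: subtree_def)
  then have "path u ! k \<notin> subtree v" using subtree_trans assms(2) by blast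
  then show ?thesis
    using target grains_fun_upd[of v t "path u ! k" "t (path u ! k) + 1"] by simp
qed simp

text \<open>The vertex \<open>v\<close> lies on the path and has room, so the grain stops at
  \<open>v\<close> or earlier, that is, inside the subtree.\<close>

lemma grains_deposit_inside:
  assumes u: "u \<in> subtree v" and v: "t v < T v" and i: "i = 0 \<or> i = 1 \<and> u \<noteq> v"
  shows "grains v (deposit i u t) = grains v t + 1"
proof -
  have uG: "u \<in> verts G" using u by (simp add: subtree_def)
  obtain m where m: "m < length (path u)" "path u ! m = v"
    using u by (auto simp: subtree_def in_set_conv_nth)
  \<comment> \<open>\<open>m = 0\<close> forces \<open>u = v\<close>, which is excluded when the
    search starts at index 1.\<close>
  have im: "i \<le> m" using i m(2) root_path_facts(4)[OF uG] by (cases m) auto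
  have bm: "below_threshold G r T t u m" using m v by (simp add: below_threshold_def)
  show ?thesis
  proof (cases rule: deposit_cases[of i u t])
    case (target k)
    have "k \<le> m" using target(4) im bm by (meson linorder_not_le)
    then have "path u ! k \<in> subtree v" using nth_mem_subtree_nth[OF uG _ m(1)] m(2) by simp
    then show ?thesis
      using target grains_fun_upd[of v t "path u ! k" "t (path u ! k) + 1"] by simp
  qed (use im bm in auto)
qed

section \<open>Local maps and maps that add a constant number of grains\<close>

lemma S_simps:
  "carrier S = \<Omega> \<rightarrow>\<^sub>E \<Omega>"
  "\<one>\<^bsub>S\<^esub> = (\<lambda>t\<in>\<Omega>. t)"
  by (simp_all add: self_maps_def)

lemma S_apply_closed [intro]: "f \<in> carrier S \<Longrightarrow> t \<in> \<Omega> \<Longrightarrow> f t \<in> \<Omega>"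
  by (auto simp: S_simps)

lemma S_mult_apply: "t \<in> \<Omega> \<Longrightarrow> (f \<otimes>\<^bsub>S\<^esub> g) t = f (g t)"
  by (simp add: self_maps_def compose_def)

definition local_map :: "(('v \<Rightarrow> nat) \<Rightarrow> 'v \<Rightarrow> nat) \<Rightarrow> bool" where
  "local_map f \<longleftrightarrow> f \<in> carrier S \<and> (\<forall>v\<in>verts G. \<forall>s\<in>\<Omega>. \<forall>t\<in>\<Omega>.
     (\<forall>e\<in>subtree v. s e = t e) \<longrightarrow> f s v = f t v)"

text \<open>Additivity in \<open>n\<close> under composition rests on the monotonicity of the value at \<open>v\<close>:
  if \<open>v\<close> is below its threshold at the end, no grain has ever passed it.\<close>

definition adds_grains :: "'v \<Rightarrow> nat \<Rightarrow> (('v \<Rightarrow> nat) \<Rightarrow> 'v \<Rightarrow> nat) \<Rightarrow> bool" where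
  "adds_grains v n f \<longleftrightarrow> f \<in> carrier S \<and> (\<forall>t\<in>\<Omega>. grains v (f t) \<le> grains v t + n \<and> t v \<le> f t v \<and>
     (f t v < T v \<longrightarrow> grains v (f t) = grains v t + n))"

lemma adds_grainsI:
  assumes "f \<in> carrier S"
    and "\<And>t. t \<in> \<Omega> \<Longrightarrow> grains v (f t) \<le> grains v t + n"
    and "\<And>t. t \<in> \<Omega> \<Longrightarrow> t v \<le> f t v"
    and "\<And>t. t \<in> \<Omega> \<Longrightarrow> f t v < T v \<Longrightarrow> grains v (f t) = grains v t + n"
  shows "adds_grains v n f"
  unfolding adds_grains_def using assms by blast

lemma adds_grainsD:
  assumes "adds_grains v n f" "t \<in> \<Omega>"
  shows "grains v (f t) \<le> grains v t + n" "t v \<le> f t v"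
    "f t v < T v \<Longrightarrow> grains v (f t) = grains v t + n" "f t \<in> \<Omega>"
  using assms unfolding adds_grains_def by auto

lemma states_le: "t \<in> \<Omega> \<Longrightarrow> v \<in> verts G \<Longrightarrow> t v \<le> T v"
  by (auto simp: states_def)

lemma states_eqI:
  assumes "s \<in> \<Omega>" "t \<in> \<Omega>" "\<And>v. v \<in> verts G \<Longrightarrow> s v = t v"
  shows "s = t"
  using assms unfolding states_def by (rule PiE_ext)

lemma local_mapI:
  assumes "f \<in> carrier S"
    and "\<And>v s t. v \<in> verts G \<Longrightarrow> s \<in> \<Omega> \<Longrightarrow> t \<in> \<Omega> \<Longrightarrow> (\<And>e. e \<in> subtree v \<Longrightarrow> s e = t e) \<Longrightarrow> f s v = f t v"
  shows "local_map f"
  unfolding local_map_def using assms by blast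

lemma local_map_one: "local_map \<one>\<^bsub>S\<^esub>"
  by (rule local_mapI) (simp_all add: self_mem_subtree S_simps)

text \<open>The definition gives equality at \<open>v\<close> only. Applying it at every
  \<open>e\<close> below \<open>v\<close>, whose subtree is contained in that of \<open>v\<close>,
  gives equality on the whole subtree, as composition requires.\<close>

lemma local_mapD:
  assumes "local_map f" "v \<in> verts G" "s \<in> \<Omega>" "t \<in> \<Omega>" "\<And>e. e \<in> subtree v \<Longrightarrow> s e = t e"
    and "e \<in> subtree v"
  shows "f s e = f t e"
proof -
  have "e \<in> verts G" using assms(6) subtree_subset by auto
  then show ?thesis using assms subtree_trans[of _ e v] unfolding local_map_def by blast
qed

lemma local_map_mult:
  assumes f: "local_map f" and g: "local_map g"
  shows "local_map (f \<otimes>\<^bsub>S\<^esub> g)"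
proof (rule local_mapI)
  interpret S: monoid S by (rule monoid_self_maps)
  have c: "f \<in> carrier S" "g \<in> carrier S" using f g unfolding local_map_def by blast+
  show "f \<otimes>\<^bsub>S\<^esub> g \<in> carrier S" using c by (rule S.m_closed)
  fix v s t
  assume v: "v \<in> verts G" and st: "s \<in> \<Omega>" "t \<in> \<Omega>" and agree: "\<And>e. e \<in> subtree v \<Longrightarrow> s e = t e"
  have "g s \<in> \<Omega>" "g t \<in> \<Omega>" using c st by auto
  then have "f (g s) v = f (g t) v"
    using local_mapD[OF f v _ _ _ self_mem_subtree[OF v]] local_mapD[OF g v st agree] by blast
  then show "(f \<otimes>\<^bsub>S\<^esub> g) s v = (f \<otimes>\<^bsub>S\<^esub> g) t v"
    using st by (simp add: S_mult_apply)
qed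

lemma local_map_pow: "local_map f \<Longrightarrow> local_map (f [^]\<^bsub>S\<^esub> (n::nat))"
proof (induction n)
  case 0
  then show ?case using local_map_one by simp
next
  case (Suc n)
  then show ?case using local_map_mult[of "f [^]\<^bsub>S\<^esub> n" f] by simp
qed

lemma adds_grains_one: "adds_grains v 0 \<one>\<^bsub>S\<^esub>"
  by (auto simp: adds_grains_def S_simps)

lemma adds_grains_mult:
  assumes f: "adds_grains v m f" and g: "adds_grains v n g"
  shows "adds_grains v (m + n) (f \<otimes>\<^bsub>S\<^esub> g)"
proof (rule adds_grainsI)
  interpret S: monoid S by (rule monoid_self_maps)
  show "f \<otimes>\<^bsub>S\<^esub> g \<in> carrier S"
    using f g unfolding adds_grains_def by (intro S.m_closed) blast+
  fix t assume t: "t \<in> \<Omega>"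
  note g = adds_grainsD[OF g t]
  note f = adds_grainsD[OF f g(4)]
  note fg = S_mult_apply[OF t, of f g]
  show "grains v ((f \<otimes>\<^bsub>S\<^esub> g) t) \<le> grains v t + (m + n)" "t v \<le> (f \<otimes>\<^bsub>S\<^esub> g) t v"
    unfolding fg using f(1,2) g(1,2) by linarith+
  \<comment> \<open>Since \<open>f\<close> does not lower the value at \<open>v\<close>, this value
    is below the threshold already after \<open>g\<close>, so both exact counts apply.\<close>
  show "grains v ((f \<otimes>\<^bsub>S\<^esub> g) t) = grains v t + (m + n)" if "(f \<otimes>\<^bsub>S\<^esub> g) t v < T v"
    using that unfolding fg using f(2,3) g(3) by linarith
qed

lemma adds_grains_pow: "adds_grains v n f \<Longrightarrow> adds_grains v (k * n) (f [^]\<^bsub>S\<^esub> (k::nat))"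
proof (induction k)
  case 0
  then show ?case using adds_grains_one by simp
next
  case (Suc k)
  then show ?case
    using adds_grains_mult[of v "k * n" "f [^]\<^bsub>S\<^esub> k" n f] by (simp add: add.commute)
qed

section \<open>Locality and grain counts of the generators\<close>

lemma sigma_carrier: "u \<in> verts G \<Longrightarrow> sigma G r T u \<in> carrier S"
  using sigma_closed by (simp add: S_simps)

lemma theta_carrier: "u \<in> verts G \<Longrightarrow> theta G r T u \<in> carrier S"
  using theta_closed by (simp add: S_simps)

lemma local_map_sigma:
  assumes u: "u \<in> verts G"
  shows "local_map (sigma G r T u)"
proof (rule local_mapI[OF sigma_carrier[OF u]])
  fix v s t
  assume v: "v \<in> verts G" and st: "s \<in> \<Omega>" "t \<in> \<Omega>" and agree: "\<And>e. e \<in> subtree v \<Longrightarrow> s e = t e"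
  show "sigma G r T u s v = sigma G r T u t v"
    unfolding sigma_eq_deposit[OF st(1)] sigma_eq_deposit[OF st(2)]
    by (rule deposit_local[OF u v agree])
qed

lemma theta_apply_self:
  assumes u: "u \<in> verts G" and t: "t \<in> \<Omega>"
  shows "theta G r T u t u = t u - 1"
proof -
  have "deposit 1 u s u = s u" for s
    unfolding deposit_apply using root_path_nth_neq[OF u] by (auto simp: below_threshold_def)
  then show ?thesis using u t by (simp add: theta_eq_deposit)
qed

text \<open>If \<open>u\<close> is below \<open>d\<close>, the two states still agree on the subtree
  of \<open>d\<close> after the value at \<open>u\<close> is lowered. Otherwise \<open>d\<close> is
  not on the path of \<open>u\<close>, and its value is unchanged.\<close>

lemma local_map_theta:
  assumes u: "u \<in> verts G"
  shows "local_map (theta G r T u)"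
proof (rule local_mapI[OF theta_carrier[OF u]])
  fix d s t
  assume d: "d \<in> verts G" and st: "s \<in> \<Omega>" "t \<in> \<Omega>" and agree: "\<And>e. e \<in> subtree d \<Longrightarrow> s e = t e"
  have sd: "s d = t d" using agree self_mem_subtree[OF d] by blast
  show "theta G r T u s d = theta G r T u t d"
  proof (cases "u \<in> subtree d")
    case True
    then have "s u = t u" using agree by blast
    moreover have "deposit 1 u (s(u := s u - 1)) d = deposit 1 u (t(u := t u - 1)) d"
      using agree \<open>s u = t u\<close> by (intro deposit_local[OF u d]) auto
    ultimately show ?thesis
      using u st sd by (simp add: theta_eq_deposit)
  next
    case False
    then have "u \<noteq> d" using self_mem_subtree[OF d] by auto
    have "path u ! k \<noteq> d" if "k < length (path u)" for k
      using False u that by (auto simp: subtree_def)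
    then have "deposit 1 u s d = s d" for s
      unfolding deposit_apply by (auto simp: below_threshold_def)
    then show ?thesis
      using u st sd \<open>u \<noteq> d\<close> by (simp add: theta_eq_deposit)
  qed
qed

lemma local_map_tau: "u \<in> verts G \<Longrightarrow> local_map (tau G r T u)"
  unfolding tau_def by (intro local_map_pow local_map_theta)

lemma adds_grains_sigma:
  assumes u: "u \<in> verts G"
  shows "adds_grains v (if u \<in> subtree v then 1 else 0) (sigma G r T u)"
proof (rule adds_grainsI[OF sigma_carrier[OF u]])
  fix t assume t: "t \<in> \<Omega>"
  show "t v \<le> sigma G r T u t v"
    unfolding sigma_eq_deposit[OF t] by (rule deposit_increasing)
  \<comment> \<open>\<open>grains_deposit_inside\<close> needs room at \<open>v\<close> before the
    move, whereas the assumption speaks of the state after it.\<close>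
  then have less: "t v < T v" if "sigma G r T u t v < T v"
    using that by linarith
  show "grains v (sigma G r T u t) \<le> grains v t + (if u \<in> subtree v then 1 else 0)"
    using grains_deposit_le grains_deposit_outside[OF u] sigma_eq_deposit[OF t] by simp
  show "grains v (sigma G r T u t) = grains v t + (if u \<in> subtree v then 1 else 0)"
    if "sigma G r T u t v < T v"
    using grains_deposit_inside[of u v t 0] less[OF that] grains_deposit_outside[OF u]
      sigma_eq_deposit[OF t] by simp
qed

text \<open>A grain taken from \<open>u\<close> below \<open>v\<close> stays in the subtree as long
  as \<open>v\<close> has room, so loss and gain cancel. The case \<open>u = v\<close> differs
  because the value at \<open>v\<close> itself is lowered.\<close>

lemma adds_grains_theta:
  assumes u: "u \<in> verts G" and "u \<noteq> v"
  shows "adds_grains v 0 (theta G r T u)"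
proof -
  have "grains v (theta G r T u t) \<le> grains v t \<and> t v \<le> theta G r T u t v \<and>
      (theta G r T u t v < T v \<longrightarrow> grains v (theta G r T u t) = grains v t)" if t: "t \<in> \<Omega>" for t
  proof (cases "t u = 0")
    case True
    then show ?thesis using theta_eq_deposit[OF u t] by simp
  next
    case False
    define t' where "t' = t(u := t u - 1)"
    have theta: "theta G r T u t = deposit 1 u t'"
      unfolding t'_def using False theta_eq_deposit[OF u t] by simp
    have v: "t' v = t v" using \<open>u \<noteq> v\<close> by (simp add: t'_def)
    have inc: "t' v \<le> deposit 1 u t' v" by (rule deposit_increasing)
    show ?thesis
    proof (cases "u \<in> subtree v")
      case True
      then have count: "grains v t' + 1 = grains v t"
        using grains_fun_upd[of v t u "t u - 1"] False unfolding t'_def by simp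
      have "grains v (deposit 1 u t') = grains v t" if "deposit 1 u t' v < T v"
        using grains_deposit_inside[OF True, of t' 1] that inc \<open>u \<noteq> v\<close> count by linarith
      then show ?thesis
        unfolding theta using grains_deposit_le[of v 1 u t'] inc v count by linarith
    next
      case False
      then have "grains v t' = grains v t"
        using grains_fun_upd[of v t u "t u - 1"] unfolding t'_def by simp
      then show ?thesis
        unfolding theta using grains_deposit_outside[OF u False, of 1 t'] inc v by linarith
    qed
  qed
  then show ?thesis by (intro adds_grainsI[OF theta_carrier[OF u]]) simp_all
qed

lemma adds_grains_tau:
  assumes "u \<in> verts G" "u \<noteq> v"
  shows "adds_grains v 0 (tau G r T u)"
  using adds_grains_pow[OF adds_grains_theta[OF assms], of "T u"] by (simp add: tau_def)

text \<open>Each \<open>theta\<close> lowers the value at \<open>u\<close> by one until it is 0, and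
  the value is at most \<open>T u\<close> at the start.\<close>

lemma tau_apply_self:
  assumes u: "u \<in> verts G" and t: "t \<in> \<Omega>"
  shows "tau G r T u t u = 0"
proof -
  interpret S: monoid S by (rule monoid_self_maps)
  have "(theta G r T u [^]\<^bsub>S\<^esub> n) t u = t u - n" if "t \<in> \<Omega>" for n :: nat and t
    using that
  \<comment> \<open>The power unfolds with the new factor on the right, which acts first; so the
    induction hypothesis is applied to the state after one \<open>theta\<close>.\<close>
  proof (induction n arbitrary: t)
    case (Suc n)
    have "theta G r T u t \<in> \<Omega>" using theta_carrier[OF u] Suc.prems by auto
    then have "(theta G r T u [^]\<^bsub>S\<^esub> n) (theta G r T u t) u = t u - 1 - n"
      using Suc.IH theta_apply_self[OF u Suc.prems] by metis
    then show ?case using S_mult_apply[OF Suc.prems] by simp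
  qed (simp add: S_simps)
  then show ?thesis using states_le[OF t u] t by (simp add: tau_def)
qed

section \<open>Words in the generators\<close>

abbreviation gens where "gens \<equiv> sigma G r T ` verts G \<union> tau G r T ` verts G"

text \<open>The argument depends on which generators occur in an element, so elements are presented
  by lists of letters. The last letter acts first.\<close>

definition word :: "(('v \<Rightarrow> nat) \<Rightarrow> 'v \<Rightarrow> nat) list \<Rightarrow> ('v \<Rightarrow> nat) \<Rightarrow> 'v \<Rightarrow> nat" where
  "word fs = foldr (\<otimes>\<^bsub>S\<^esub>) fs \<one>\<^bsub>S\<^esub>"

lemma word_simps: "word [] = \<one>\<^bsub>S\<^esub>" "word (f # fs) = f \<otimes>\<^bsub>S\<^esub> word fs"
  by (simp_all add: word_def)

lemma local_map_gens: "f \<in> gens \<Longrightarrow> local_map f"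
  using local_map_sigma local_map_tau by auto

lemma local_map_word: "set fs \<subseteq> gens \<Longrightarrow> local_map (word fs)"
proof (induction fs)
  case Nil
  show ?case unfolding word_simps by (rule local_map_one)
next
  case (Cons f fs)
  then have "local_map f" "local_map (word fs)" using local_map_gens by auto
  then show ?case unfolding word_simps by (rule local_map_mult)
qed

lemma word_carrier: "set fs \<subseteq> gens \<Longrightarrow> word fs \<in> carrier S"
  using local_map_word unfolding local_map_def by blast

lemma word_append:
  assumes "set fs \<subseteq> gens" "set gs \<subseteq> gens"
  shows "word (fs @ gs) = word fs \<otimes>\<^bsub>S\<^esub> word gs"
proof -
  interpret S: monoid S by (rule monoid_self_maps)
  show ?thesis using assms
  proof (induction fs)
    case Nil
    then show ?case using S.l_one[OF word_carrier] by (simp add: word_simps)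
  next
    case (Cons f fs)
    have "f \<in> carrier S" using Cons.prems generators_closed by auto
    then show ?case
      using Cons word_carrier by (simp add: word_simps S.m_assoc)
  qed
qed

text \<open>Among the generators only \<open>tau\<close> at \<open>v\<close> can lower the value at
  \<open>v\<close>.\<close>

lemma adds_grains_gens:
  assumes "f \<in> gens" "f \<noteq> tau G r T v"
  shows "\<exists>n. adds_grains v n f"
proof -
  consider u where "u \<in> verts G" "f = sigma G r T u" | u where "u \<in> verts G" "u \<noteq> v" "f = tau G r T u"
    using assms by auto
  then show ?thesis
    by cases (use adds_grains_sigma adds_grains_tau in metis)+
qed

lemma adds_grains_word:
  assumes "\<And>f. f \<in> set fs \<Longrightarrow> adds_grains v (n f) f"
  shows "adds_grains v (sum_list (map n fs)) (word fs)"
  using assms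
proof (induction fs)
  case Nil
  show ?case using adds_grains_one by (simp add: word_simps)
next
  case (Cons f fs)
  then have "adds_grains v (n f + sum_list (map n fs)) (f \<otimes>\<^bsub>S\<^esub> word fs)"
    by (intro adds_grains_mult) auto
  then show ?case by (simp add: word_simps)
qed

section \<open>Stabilization of large powers of a word\<close>

lemma grains_le:
  assumes t: "t \<in> \<Omega>"
  shows "grains v t \<le> sum T (verts G)"
proof -
  have "grains v t \<le> sum T (subtree v)"
    unfolding grains_def using states_le[OF t] subtree_subset by (intro sum_mono) auto
  also have "\<dots> \<le> sum T (verts G)"
    using finite_verts subtree_subset by (intro sum_mono2) auto
  finally show ?thesis .
qed

text \<open>If \<open>v\<close> had room at the end, all \<open>n\<close> added grains would still
  be in its subtree, more than the thresholds of all vertices together allow.\<close>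

lemma adds_many_grains:
  assumes f: "adds_grains v n f" and n: "sum T (verts G) < n" and v: "v \<in> verts G" and t: "t \<in> \<Omega>"
  shows "f t v = T v"
proof (rule ccontr)
  note f = adds_grainsD[OF f t]
  assume "f t v \<noteq> T v"
  then have "f t v < T v" using states_le[OF f(4) v] by simp
  then show False using f(3) grains_le[OF f(4), of v] n by simp
qed

text \<open>If \<open>f\<close> left more at \<open>v\<close> than \<open>g\<close>, then
  \<open>v\<close> would have room after \<open>g\<close>, so \<open>g\<close> would have kept every
  grain of the subtree. With equal values strictly below \<open>v\<close>, the map \<open>f\<close>
  would then have created grains. Exchanging \<open>f\<close> and \<open>g\<close> turns the
  inequality into equality.\<close>

lemma adds_no_grains_le:
  assumes f: "adds_grains v 0 f" and g: "adds_grains v 0 g" and v: "v \<in> verts G" and t: "t \<in> \<Omega>"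
    and agree: "\<And>e. e \<in> subtree v \<Longrightarrow> e \<noteq> v \<Longrightarrow> f t e = g t e"
  shows "f t v \<le> g t v"
proof (rule ccontr)
  assume less: "\<not> f t v \<le> g t v"
  note f = adds_grainsD[OF f t] and g = adds_grainsD[OF g t]
  have "g t v < T v" using less states_le[OF f(4) v] by simp
  then have "grains v (f t) \<le> grains v (g t)" using f(1) g(3) by simp
  moreover have "grains v s = s v + sum s (subtree v - {v})" for s
    unfolding grains_def using sum.remove[OF finite_subtree self_mem_subtree[OF v]] .
  moreover have "sum (f t) (subtree v - {v}) = sum (g t) (subtree v - {v})"
    using agree by (intro sum.cong) auto
  ultimately show False using less by simp
qed

text \<open>Stated for all large \<open>N\<close> rather than for some \<open>N\<close>, so that the
  claims for the finitely many vertices strictly below \<open>v\<close> hold simultaneously.\<close>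

lemma eventually_agree_at:
  assumes fs: "set fs \<subseteq> gens" and x: "x \<in> set fs" and v: "v \<in> verts G"
  shows "\<forall>\<^sub>F N in sequentially. \<forall>t\<in>\<Omega>. (word fs [^]\<^bsub>S\<^esub> N) t v = (word fs [^]\<^bsub>S\<^esub> N) (x t) v"
  using v
\<comment> \<open>A path to the root has at most \<open>card (verts G)\<close> vertices, so this
  measure strictly decreases away from the root.\<close>
proof (induction "card (verts G) - length (path v)" arbitrary: v rule: less_induct)
  case (less v)
  interpret S: monoid S by (rule monoid_self_maps)
  let ?w = "word fs"
  have w: "?w \<in> carrier S" and xS: "x \<in> carrier S"
    using word_carrier[OF fs] subsetD[OF generators_closed] x fs by blast+
  have pow_state: "(?w [^]\<^bsub>S\<^esub> N) t \<in> \<Omega>" if "t \<in> \<Omega>" for N :: nat and t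
    using S.nat_pow_closed[OF w, of N] that by auto
  have x_state: "x t \<in> \<Omega>" if "t \<in> \<Omega>" for t using xS that by auto
  have "\<forall>\<^sub>F N in sequentially. \<forall>t\<in>\<Omega>. (?w [^]\<^bsub>S\<^esub> N) t e = (?w [^]\<^bsub>S\<^esub> N) (x t) e"
    if e: "e \<in> subtree v - {v}" for e
  proof (rule less.hyps)
    show eG: "e \<in> verts G" using e subtree_subset by auto
    have "length (path e) \<le> card (verts G)"
      using root_path_facts(1,2)[OF eG] card_mono[OF finite_verts] by (metis distinct_card)
    then show "card (verts G) - length (path e) < card (verts G) - length (path v)"
      using length_root_path_less[of e v] e by simp
  qed
  then have below: "\<forall>\<^sub>F N in sequentially. \<forall>e\<in>subtree v - {v}. \<forall>t\<in>\<Omega>.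
      (?w [^]\<^bsub>S\<^esub> N) t e = (?w [^]\<^bsub>S\<^esub> N) (x t) e"
    using finite_subtree by (intro eventually_ball_finite) auto
  show ?case
  proof (cases "tau G r T v \<in> set fs")
    case True
    then obtain ys zs where split: "fs = ys @ tau G r T v # zs" by (auto simp: in_set_conv_decomp)
    have sub: "set ys \<subseteq> gens" "set zs \<subseteq> gens" using fs split by auto
    let ?y = "word ys" and ?z = "word zs" and ?T = "tau G r T v"
    have w_apply: "?w s = ?y (?T (?z s))" if "s \<in> \<Omega>" for s
    proof -
      have "?w = ?y \<otimes>\<^bsub>S\<^esub> (?T \<otimes>\<^bsub>S\<^esub> ?z)"
        using word_append[of ys "?T # zs"] fs split by (simp add: word_simps)
      then show ?thesis using that by (simp add: S_mult_apply)
    qed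
    \<comment> \<open>The agreement strictly below \<open>v\<close> survives the suffix
      \<open>zs\<close>; then \<open>tau\<close> sets both values at \<open>v\<close> to 0, so the
      states agree on the whole subtree and the prefix \<open>ys\<close> preserves this.\<close>
    have sync: "?w s v = ?w s' v"
      if s: "s \<in> \<Omega>" "s' \<in> \<Omega>" and agree: "\<And>e. e \<in> subtree v - {v} \<Longrightarrow> s e = s' e" for s s'
    proof -
      have z: "?z s \<in> \<Omega>" "?z s' \<in> \<Omega>" using word_carrier[OF sub(2)] s by auto
      have T: "?T (?z s) \<in> \<Omega>" "?T (?z s') \<in> \<Omega>"
        using local_map_tau[OF less.prems] z unfolding local_map_def by auto
      have "?T (?z s) e = ?T (?z s') e" if e: "e \<in> subtree v" for e
      proof (cases "e = v")
        case True
        then show ?thesis using tau_apply_self[OF less.prems] z by simp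
      next
        case False
        have eG: "e \<in> verts G" using e subtree_subset by auto
        \<comment> \<open>Here \<open>d = v\<close> is impossible: \<open>e\<close> and
          \<open>v\<close> would lie in each other's subtrees.\<close>
        have "d \<in> subtree v - {v}" if "d \<in> subtree e" for d
          using that subtree_trans[OF that e] length_root_path_less[OF e False]
            length_root_path_less[of v e] False by auto
        then have "?z s d = ?z s' d" if "d \<in> subtree e" for d
          using that agree by (intro local_mapD[OF local_map_word[OF sub(2)] eG s]) auto
        then show ?thesis
          using local_mapD[OF local_map_tau[OF less.prems] eG z] self_mem_subtree[OF eG] by blast
      qed
      then show ?thesis
        using local_mapD[OF local_map_word[OF sub(1)] less.prems T] self_mem_subtree[OF less.prems]
          w_apply s by simp
    qed
    have step: "\<forall>\<^sub>F N in sequentially. \<forall>t\<in>\<Omega>. (?w [^]\<^bsub>S\<^esub> Suc N) t v = (?w [^]\<^bsub>S\<^esub> Suc N) (x t) v"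
      using below
    proof (rule eventually_mono, intro ballI)
      fix N :: nat and t
      assume *: "\<forall>e\<in>subtree v - {v}. \<forall>t\<in>\<Omega>. (?w [^]\<^bsub>S\<^esub> N) t e = (?w [^]\<^bsub>S\<^esub> N) (x t) e" and t: "t \<in> \<Omega>"
      \<comment> \<open>The additional factor must act last, so it is split off on the left.\<close>
      have "(?w [^]\<^bsub>S\<^esub> Suc N) s = ?w ((?w [^]\<^bsub>S\<^esub> N) s)" if "s \<in> \<Omega>" for s
        using S.nat_pow_Suc2[OF w] that by (simp add: S_mult_apply)
      then show "(?w [^]\<^bsub>S\<^esub> Suc N) t v = (?w [^]\<^bsub>S\<^esub> Suc N) (x t) v"
        using sync[OF pow_state pow_state] * t x_state by simp
    qed
    show ?thesis by (rule iffD1[OF eventually_sequentially_Suc]) (rule step)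
  next
    case False
    have "\<forall>f\<in>set fs. \<exists>n. adds_grains v n f"
      by (intro ballI adds_grains_gens) (use fs False in blast)+
    then obtain n where "\<forall>f\<in>set fs. adds_grains v (n f) f"
      by (rule bchoice[THEN exE])
    then have n: "adds_grains v (n f) f" if "f \<in> set fs" for f
      using that by (rule bspec)
    define k where "k = sum_list (map n fs)"
    have pow: "adds_grains v (N * k) (?w [^]\<^bsub>S\<^esub> N)" for N :: nat
      unfolding k_def by (intro adds_grains_pow adds_grains_word n)
    \<comment> \<open>Reading the right-hand side as the value at \<open>t\<close> of a single map
      lets both sides be counted from the same initial state.\<close>
    have pow_x: "adds_grains v (N * k + n x) (?w [^]\<^bsub>S\<^esub> N \<otimes>\<^bsub>S\<^esub> x)" for N :: nat
      by (intro adds_grains_mult pow n x)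
    have "n x \<le> k" unfolding k_def using x by (simp add: member_le_sum_list)
    show ?thesis
    proof (cases "k = 0")
      case True
      then have "n x = 0" using \<open>n x \<le> k\<close> by simp
      show ?thesis using below
      proof (rule eventually_mono, intro ballI)
        fix N :: nat and t
        assume *: "\<forall>e\<in>subtree v - {v}. \<forall>t\<in>\<Omega>. (?w [^]\<^bsub>S\<^esub> N) t e = (?w [^]\<^bsub>S\<^esub> N) (x t) e" and t: "t \<in> \<Omega>"
        have agree: "(?w [^]\<^bsub>S\<^esub> N) t e = (?w [^]\<^bsub>S\<^esub> N \<otimes>\<^bsub>S\<^esub> x) t e" if "e \<in> subtree v" "e \<noteq> v" for e
          using * t that by (simp add: S_mult_apply)
        have add: "adds_grains v 0 (?w [^]\<^bsub>S\<^esub> N)" "adds_grains v 0 (?w [^]\<^bsub>S\<^esub> N \<otimes>\<^bsub>S\<^esub> x)"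
          using pow[of N] pow_x[of N] True \<open>n x = 0\<close> by simp_all
        have "(?w [^]\<^bsub>S\<^esub> N) t v = (?w [^]\<^bsub>S\<^esub> N \<otimes>\<^bsub>S\<^esub> x) t v"
          using adds_no_grains_le[OF add less.prems t] adds_no_grains_le[OF add(2,1) less.prems t]
            agree by (simp add: order_antisym)
        then show "(?w [^]\<^bsub>S\<^esub> N) t v = (?w [^]\<^bsub>S\<^esub> N) (x t) v"
          using t by (simp add: S_mult_apply)
      qed
    next
      case False
      show ?thesis
      \<comment> \<open>Each application contributes \<open>k > 0\<close> grains, so this bound
        makes \<open>v\<close> full whatever the initial state, in particular from both
        \<open>t\<close> and \<open>x t\<close>.\<close>
      proof (rule eventually_mono[OF eventually_gt_at_top[of "sum T (verts G)"]], intro ballI)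
        fix N :: nat and t
        assume N: "sum T (verts G) < N" and t: "t \<in> \<Omega>"
        have "N * 1 \<le> N * k" using False by (intro mult_le_mono2) simp
        then have "sum T (verts G) < N * k" using N by linarith
        then show "(?w [^]\<^bsub>S\<^esub> N) t v = (?w [^]\<^bsub>S\<^esub> N) (x t) v"
          using adds_many_grains[OF pow _ less.prems] t x_state by simp
      qed
    qed
  qed
qed

text \<open>There are finitely many letters and vertices, so one exponent serves them all. Agreement
  on all states gives equality of maps, as both are extensional.\<close>

lemma word_pow_absorbs_letters:
  assumes fs: "set fs \<subseteq> gens"
  obtains N :: nat where "\<And>x. x \<in> set fs \<Longrightarrow> word fs [^]\<^bsub>S\<^esub> N \<otimes>\<^bsub>S\<^esub> x = word fs [^]\<^bsub>S\<^esub> N"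
proof -
  interpret S: monoid S by (rule monoid_self_maps)
  have "\<forall>\<^sub>F N in sequentially. \<forall>x\<in>set fs. \<forall>v\<in>verts G. \<forall>t\<in>\<Omega>.
      (word fs [^]\<^bsub>S\<^esub> N) t v = (word fs [^]\<^bsub>S\<^esub> N) (x t) v"
    by (rule eventually_ball_finite, simp, rule ballI, rule eventually_ball_finite[OF finite_verts],
        rule ballI, rule eventually_agree_at[OF fs])
  then obtain N :: nat where N: "\<forall>x\<in>set fs. \<forall>v\<in>verts G. \<forall>t\<in>\<Omega>.
      (word fs [^]\<^bsub>S\<^esub> N) t v = (word fs [^]\<^bsub>S\<^esub> N) (x t) v"
    by (auto simp: eventually_sequentially)
  have w: "word fs [^]\<^bsub>S\<^esub> N \<in> carrier S" using S.nat_pow_closed[OF word_carrier[OF fs]] .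
  show thesis
  proof
    fix x assume x: "x \<in> set fs"
    then have xS: "x \<in> carrier S" using fs subsetD[OF generators_closed] by blast
    have "(word fs [^]\<^bsub>S\<^esub> N \<otimes>\<^bsub>S\<^esub> x) t = (word fs [^]\<^bsub>S\<^esub> N) t" if t: "t \<in> \<Omega>" for t
    proof (rule states_eqI)
      show "(word fs [^]\<^bsub>S\<^esub> N \<otimes>\<^bsub>S\<^esub> x) t \<in> \<Omega>" using S.m_closed[OF w xS] t by auto
      show "(word fs [^]\<^bsub>S\<^esub> N) t \<in> \<Omega>" using w t by auto
    qed (use N x t in \<open>simp add: S_mult_apply\<close>)
    then show "word fs [^]\<^bsub>S\<^esub> N \<otimes>\<^bsub>S\<^esub> x = word fs [^]\<^bsub>S\<^esub> N"
      using PiE_ext[of _ \<Omega> "\<lambda>_. \<Omega>"] S.m_closed[OF w xS] w by (metis S_simps(1))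
  qed
qed

section \<open>R-triviality of the generated monoid\<close>

lemma generated_imp_word:
  assumes "f \<in> generated_submonoid S gens"
  shows "\<exists>fs. set fs \<subseteq> gens \<and> f = word fs"
proof -
  interpret S: monoid S by (rule monoid_self_maps)
  show ?thesis using assms
  proof induction
    case one
    show ?case by (rule exI[of _ "[]"]) (simp add: word_simps)
  next
    case (incl a)
    then have "a \<in> carrier S" by (rule subsetD[OF generators_closed])
    then have "a = word [a]" by (simp add: word_simps)
    then show ?case using incl by (intro exI[of _ "[a]"]) simp
  next
    case (mult a b)
    then obtain fs gs where "set fs \<subseteq> gens" "a = word fs" "set gs \<subseteq> gens" "b = word gs" by blast
    then show ?case by (intro exI[of _ "fs @ gs"]) (simp add: word_append)
  qed
qed

lemma R_trivial_threshold_monoid: "R_trivial (threshold_monoid G r T)"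
  unfolding R_trivial_def
proof (intro ballI impI)
  interpret S: monoid S by (rule monoid_self_maps)
  let ?M = "threshold_monoid G r T"
  interpret M: monoid ?M by (rule monoid_threshold_monoid)
  have carrier: "carrier ?M = generated_submonoid S gens" and mult: "(\<otimes>\<^bsub>?M\<^esub>) = (\<otimes>\<^bsub>S\<^esub>)"
    by (simp_all add: threshold_monoid_def)
  fix a b
  assume a: "a \<in> carrier ?M" and b: "b \<in> carrier ?M"
    and eq: "a <#\<^bsub>?M\<^esub> carrier ?M = b <#\<^bsub>?M\<^esub> carrier ?M"
  have self: "x \<in> x <#\<^bsub>?M\<^esub> carrier ?M" if "x \<in> carrier ?M" for x
    unfolding l_coset_def using M.r_one[OF that] M.one_closed by (metis UN_iff singletonI)
  obtain c d where c: "c \<in> carrier ?M" "a = b \<otimes>\<^bsub>S\<^esub> c" and d: "d \<in> carrier ?M" "b = a \<otimes>\<^bsub>S\<^esub> d"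
  proof -
    have "a \<in> b <#\<^bsub>?M\<^esub> carrier ?M" "b \<in> a <#\<^bsub>?M\<^esub> carrier ?M"
      using self[OF a] self[OF b] eq by simp_all
    then show thesis using that unfolding l_coset_def mult by blast
  qed
  obtain cs ds where cs: "set cs \<subseteq> gens" "c = word cs" and ds: "set ds \<subseteq> gens" "d = word ds"
    using generated_imp_word c(1) d(1) carrier by metis
  have gens: "set (ds @ cs) \<subseteq> gens" using cs ds by simp
  \<comment> \<open>The letters of \<open>d\<close> occur in this word, so a large power of
    \<open>w\<close> absorbs each of them from the right.\<close>
  define w where "w = word (ds @ cs)"
  have w_eq: "w = d \<otimes>\<^bsub>S\<^esub> c" using word_append cs ds by (simp add: w_def)
  obtain as where "set as \<subseteq> gens" "a = word as" using generated_imp_word a carrier by metis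
  then have S: "a \<in> carrier S" "c \<in> carrier S" "d \<in> carrier S" "w \<in> carrier S"
    using word_carrier cs ds gens unfolding w_def by blast+
  obtain N :: nat where N: "\<And>x. x \<in> set (ds @ cs) \<Longrightarrow> w [^]\<^bsub>S\<^esub> N \<otimes>\<^bsub>S\<^esub> x = w [^]\<^bsub>S\<^esub> N"
    using word_pow_absorbs_letters[OF gens] unfolding w_def by blast
  have wN: "w [^]\<^bsub>S\<^esub> N \<in> carrier S" using S.nat_pow_closed[OF S(4)] .
  have absorb: "w [^]\<^bsub>S\<^esub> N \<otimes>\<^bsub>S\<^esub> word fs = w [^]\<^bsub>S\<^esub> N" if "set fs \<subseteq> set ds" for fs
    using that
  proof (induction fs)
    case Nil
    then show ?case using S.r_one[OF wN] by (simp add: word_simps)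
  next
    case (Cons f fs)
    have "set fs \<subseteq> gens" using Cons.prems ds by auto
    moreover have "f \<in> carrier S" using Cons.prems ds subsetD[OF generators_closed, of f] by auto
    ultimately have "w [^]\<^bsub>S\<^esub> N \<otimes>\<^bsub>S\<^esub> word (f # fs) = w [^]\<^bsub>S\<^esub> N \<otimes>\<^bsub>S\<^esub> f \<otimes>\<^bsub>S\<^esub> word fs"
      using word_carrier wN by (simp add: word_simps S.m_assoc)
    then show ?case using Cons N by simp
  qed
  \<comment> \<open>\<open>a d c = b c = a\<close>.\<close>
  have aw: "a \<otimes>\<^bsub>S\<^esub> w = a"
    unfolding w_eq S.m_assoc[OF S(1,3,2), symmetric] using c(2) d(2) by metis
  have a_pow: "a \<otimes>\<^bsub>S\<^esub> w [^]\<^bsub>S\<^esub> n = a" for n :: nat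
  proof (induction n)
    case 0
    then show ?case using S.r_one[OF S(1)] by simp
  next
    case (Suc n)
    have "a \<otimes>\<^bsub>S\<^esub> w [^]\<^bsub>S\<^esub> Suc n = (a \<otimes>\<^bsub>S\<^esub> w [^]\<^bsub>S\<^esub> n) \<otimes>\<^bsub>S\<^esub> w"
      using S.m_assoc[OF S(1) S.nat_pow_closed[OF S(4)] S(4)] by simp
    then show ?case using Suc aw by simp
  qed
  \<comment> \<open>Inserting the power of \<open>w\<close> after \<open>a\<close> allows
    \<open>d\<close> to be absorbed: \<open>b = a d = a w^N d = a w^N = a\<close>.\<close>
  then have "a \<otimes>\<^bsub>S\<^esub> d = a \<otimes>\<^bsub>S\<^esub> (w [^]\<^bsub>S\<^esub> N \<otimes>\<^bsub>S\<^esub> d)"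
    using S.m_assoc[OF S(1) wN S(3)] by metis
  also have "\<dots> = a" using absorb[of ds] ds(2) a_pow by simp
  finally show "a = b" using d(2) by simp
qed

end

theorem theorem5p9:
  fixes G :: "('v, 'e) pre_digraph" and r :: 'v and T :: "'v \<Rightarrow> nat"
  assumes "arborescence_with_thresholds G r T"
  shows "R_trivial (threshold_monoid G r T)"
  using arborescence_with_thresholds.R_trivial_threshold_monoid[OF assms] .

end
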